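(* Let $X_1=\{x_1,x_2\}$ be the trivial biquandle of two elements (with operations $x^y=x_y=x$ for all $x,y\in X_1$), and let $K$ be an oriented two-component virtual link, represented by a diagram, also denoted $K$, with an even number of crossing points (over and under) on every component. Let $L$ be the element $$L=\sum_{(a,b)\in\{(x_1,x_2),(x_2,x_1)\}}\left(D^{+}_{a,b}-D^{-}_{a,b}\right)$$ of the two-component truncated degree 1 $X_1$-labeled Polyak algebra, where $D^{\varepsilon}_{a,b}$ is the two-component diagram with exactly one dashed arrow, of sign $\varepsilon$, joining the two different circles, with label $a$ on both sides of its tail and label $b$ on both sides of its head. Then the finite type enhanced polynomial invariant of $K$ with respect to $X_1$ and $L$ is $$\Phi_{X_1}^{L}(K)=2+2u^{2\,\mathrm{lk}(K)},$$ where $\mathrm{lk}(K)$ is the linking number of $K$.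
   Context: **Gauss diagrams.** A two-component Gauss diagram is a set of two (unordered) oriented circles together with finitely many arrows, each carrying a sign $+$ or $-$, connecting distinct points on the circles. It represents a two-component oriented virtual link: circles are components, and each arrow represents a classical crossing, going from its over-instance (tail) to its under-instance (head) and labeled by the crossing sign. Arrows joining different circles represent multicomponent crossings. Virtual crossings are not recorded. The crossing points on a component are the arrow heads and tails on its circle. The semiarcs are the portions of the circles between consecutive crossing points (a circle without crossing points counts as one semiarc). Diagrams are considered up to orientation-preserving homeomorphisms of the circles and permutation of the circles. **Labelings.** For the trivial biquandle $X_1=\{x_1,x_2\}$, an $X_1$-labeling of a diagram is an assignment of an element of $X_1$ to each semiarc such that the label is unchanged in passing through any crossing point, over or under (this is the biquandle labeling rule for the operations $x^y=x_y=x$). $\mathcal{L}(K,X_1)$ denotes the set of $X_1$-labelings of the diagram $K$; each one is regarded as an $X_1$-labeled Gauss diagram. A locally $X_1$-labeled Gauss diagram is a Gauss diagram in which each arrow carries a pair of labels at its tail and a pair of labels at its head (the labels of the semiarcs just before and just after that point) satisfying the labeling rule at that arrow; labels at different arrows need not be compatible along the circles. Here the two labels of each pair are equal, so an arrow is described by its sign, one tail label and one head label. **Arrow algebra and inner product.** The two-component $X_1$-labeled arrow algebra $\mathcal{A}^{X_1}$ is the free $\mathbb{Z}$-module generated by locally $X_1$-labeled two-component Gauss diagrams. A dashed arrow in a diagram denotes the difference (diagram with that arrow as an ordinary arrow) minus (diagram with that arrow deleted). Equivalently, each ordinary labeled Gauss diagram equals the sum, over all subsets of its arrows, of the diagram obtained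 by keeping exactly those arrows, with their signs and labels, and making them dashed. Diagrams with only dashed arrows form a distinguished basis, and $\langle\cdot,\cdot\rangle:\mathcal{A}^{X_1}\times\mathcal{A}^{X_1}\to\mathbb{Z}$ is the bilinear form for which this basis is orthonormal. **Polyak algebra.** The $X_1$-labeled Polyak algebra is the orthogonal complement in $\mathcal{A}^{X_1}$ of the submodule generated by the differences $D-D'$ of diagrams related by $X_1$-labeled Reidemeister moves. Its degree $n$ truncation is obtained by setting all diagrams with more than $n$ arrows to zero. **Enhancement.** For an element $A$ of the truncated $X_1$-labeled Polyak algebra, the finite type enhanced polynomial invariant is $$\Phi_{X_1}^{A}(K)=\sum_{D\in\mathcal{L}(K,X_1)}u^{\langle A,D\rangle}.$$ **Linking number.** $\mathrm{lk}(K)$ is half the sum of the signs of the multicomponent crossings of $K$ (classical crossings between the two different components). *)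

theory Defs
  imports Complex_Main "HOL-Library.Poly_Mapping" "HOL-Library.FuncSet"
    "HOL-Combinatorics.Transposition"
begin

section \<open>Two-component Gauss diagrams\<close>

datatype csign = Pos | Neg

fun csign_val :: "csign \<Rightarrow> int" where
  "csign_val Pos = 1"
| "csign_val Neg = -1"

datatype arrow_end = Tail | Head

text \<open>
  A crossing point is an arrow name together with one of its two ends and some decoration of
  type \<open>'l\<close>. The two circles are indexed by \<^typ>\<open>bool\<close>; each one is the list of
  its crossing points in the order of the orientation, starting anywhere. The domain of
  \<open>asign\<close> is the set of arrows. An undecorated diagram has \<open>'l = unit\<close>.
\<close>

type_synonym 'l pt = "nat \<times> arrow_end \<times> 'l"

datatype 'l diagram =
  Diagram (circ: "bool \<Rightarrow> 'l pt list") (asign: "nat \<rightharpoonup> csign")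

definition arrows :: "'l diagram \<Rightarrow> nat set" where
  "arrows D = dom (asign D)"

definition endpoint :: "'l pt \<Rightarrow> nat \<times> arrow_end" where
  "endpoint = (\<lambda>(i, e, _). (i, e))"

definition endpoints :: "'l diagram \<Rightarrow> bool \<Rightarrow> (nat \<times> arrow_end) list" where
  "endpoints D b = map endpoint (circ D b)"

definition gauss_diagram :: "'l diagram \<Rightarrow> bool" where
  "gauss_diagram D \<longleftrightarrow>
     distinct (endpoints D False @ endpoints D True) \<and>
     set (endpoints D False @ endpoints D True) = arrows D \<times> UNIV"

definition rename_pt :: "(nat \<Rightarrow> nat) \<Rightarrow> 'l pt \<Rightarrow> 'l pt" where
  "rename_pt f = (\<lambda>(i, e, l). (f i, e, l))"

text \<open>
  Orientation-preserving homeomorphisms of the circles become rotations of the lists, and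
  \<open>p\<close> permutes the circles. Asking \<open>f\<close> to be a bijection of all names loses nothing, since a
  bijection between finite sets of names extends to one.
\<close>

definition diagram_iso :: "'l diagram \<Rightarrow> 'l diagram \<Rightarrow> bool" where
  "diagram_iso D D' \<longleftrightarrow>
     (\<exists>(f :: nat \<Rightarrow> nat) (p :: bool \<Rightarrow> bool). bij f \<and> bij p \<and> asign D' \<circ> f = asign D \<and>
        (\<forall>b. \<exists>n. circ D' (p b) = rotate n (map (rename_pt f) (circ D b))))"

text \<open>Keep exactly the arrows in \<open>S\<close>, with their signs and decorations.\<close>

definition keep :: "nat set \<Rightarrow> 'l diagram \<Rightarrow> 'l diagram" where
  "keep S D = Diagram (\<lambda>b. filter (\<lambda>q. fst q \<in> S) (circ D b)) (asign D |` S)"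

definition even_crossing_points :: "'l diagram \<Rightarrow> bool" where
  "even_crossing_points K \<longleftrightarrow> (\<forall>b. even (length (circ K b)))"

definition multicomponent :: "'l diagram \<Rightarrow> nat \<Rightarrow> bool" where
  "multicomponent K i \<longleftrightarrow>
     (\<exists>b. (i, Tail) \<in> set (endpoints K b) \<and> (i, Head) \<in> set (endpoints K (\<not> b)))"

definition lk :: "'l diagram \<Rightarrow> rat" where
  "lk K = of_int (\<Sum>i | i \<in> arrows K \<and> multicomponent K i. csign_val (the (asign K i))) / 2"


section \<open>Labelings by the trivial biquandle of two elements\<close>

datatype X1 = x1 | x2

text \<open>
  Both biquandle operations of \<open>X1\<close> are the first projection, so that the labeling rule at a
  crossing, over or under and of either sign, says that the label is unchanged.

  Semiarc \<open>(b, j)\<close> is the one that ends at the crossing point number \<open>j\<close> of circle \<open>b\<close>;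
  hence the one that starts there is \<open>(b, Suc j mod n)\<close>, where \<open>n\<close> is the number
  of crossing points. A circle without crossing points has the single semiarc \<open>(b, 0)\<close>.
\<close>

definition semiarcs :: "'l diagram \<Rightarrow> (bool \<times> nat) set" where
  "semiarcs K = {(b, j). j < max 1 (length (circ K b))}"

definition labelings :: "'l diagram \<Rightarrow> (bool \<times> nat \<Rightarrow> X1) set" where
  "labelings K =
     {\<phi> \<in> semiarcs K \<rightarrow>\<^sub>E UNIV.
        \<forall>b j. j < length (circ K b) \<longrightarrow> \<phi> (b, Suc j mod length (circ K b)) = \<phi> (b, j)}"

text \<open>
  The decoration of a crossing point of a locally labeled diagram is the pair of the labels just
  before and just after it.
\<close>

type_synonym ldiagram = "(X1 \<times> X1) diagram"

definition locally_labeled :: "ldiagram \<Rightarrow> bool" where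
  "locally_labeled D \<longleftrightarrow>
     gauss_diagram D \<and> (\<forall>b. \<forall>(i, e, l, l') \<in> set (circ D b). l' = l)"

definition labeled_diagram :: "'l diagram \<Rightarrow> (bool \<times> nat \<Rightarrow> X1) \<Rightarrow> ldiagram" where
  "labeled_diagram K \<phi> =
     Diagram
       (\<lambda>b. map (\<lambda>j. case circ K b ! j of (i, e, _) \<Rightarrow>
                     (i, e, \<phi> (b, j), \<phi> (b, Suc j mod length (circ K b))))
              [0..<length (circ K b)])
       (asign K)"

lemma filter_rotate: "\<exists>m. filter P (rotate n xs) = rotate m (filter P xs)"
proof -
  let ?k = "n mod length xs"
  have "filter P (rotate n xs) = filter P (drop ?k xs) @ filter P (take ?k xs)"
    by (simp add: rotate_drop_take)
  also have "\<dots> = rotate (length (filter P (take ?k xs)))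
                     (filter P (take ?k xs) @ filter P (drop ?k xs))"
    by (simp add: rotate_append)
  also have "filter P (take ?k xs) @ filter P (drop ?k xs) = filter P xs"
    by (metis append_take_drop_id filter_append)
  finally show ?thesis by blast
qed

lemma rotate_inverse: "\<exists>m. rotate m (rotate n xs) = xs"
proof (cases "xs = []")
  case False
  let ?m = "length xs - n mod length xs"
  have "rotate ?m (rotate n xs) = rotate (?m + n mod length xs) xs"
    by (metis rotate_conv_mod rotate_rotate)
  also have "?m + n mod length xs = length xs"
    using False by (simp add: less_imp_le)
  finally show ?thesis by (metis rotate_length01 rotate_conv_mod mod_self rotate0 id_apply)
qed simp

lemma rename_pt_comp: "rename_pt f \<circ> rename_pt g = rename_pt (f \<circ> g)"
  by (auto simp: rename_pt_def fun_eq_iff)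

lemma rename_pt_id: "rename_pt id = id"
  by (auto simp: rename_pt_def fun_eq_iff)

lemma fst_rename_pt [simp]: "fst (rename_pt f q) = f (fst q)"
  by (cases q) (simp add: rename_pt_def)

lemma diagram_iso_refl: "diagram_iso D D"
  unfolding diagram_iso_def
  by (rule exI[of _ id], rule exI[of _ id]) (auto simp: rename_pt_id intro: exI[of _ 0])

lemma diagram_iso_sym:
  assumes "diagram_iso D D'" shows "diagram_iso D' D"
proof -
  from assms obtain f p where f: "bij f" and p: "bij p" and s: "asign D' \<circ> f = asign D"
    and c: "\<And>b. \<exists>n. circ D' (p b) = rotate n (map (rename_pt f) (circ D b))"
    unfolding diagram_iso_def by blast
  have "\<exists>n. circ D (inv p b) = rotate n (map (rename_pt (inv f)) (circ D' b))" for b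
  proof -
    obtain n where n: "circ D' b = rotate n (map (rename_pt f) (circ D (inv p b)))"
      using c[of "inv p b"] p by (auto simp: bij_is_surj surj_f_inv_f)
    have "map (rename_pt (inv f)) (circ D' b) =
          rotate n (map (rename_pt (inv f) \<circ> rename_pt f) (circ D (inv p b)))"
      by (simp add: n rotate_map)
    also have "\<dots> = rotate n (circ D (inv p b))"
      using f by (simp add: rename_pt_comp rename_pt_id bij_is_inj)
    finally have *: "map (rename_pt (inv f)) (circ D' b) = rotate n (circ D (inv p b))" .
    obtain m where "rotate m (rotate n (circ D (inv p b))) = circ D (inv p b)"
      using rotate_inverse by blast
    then show ?thesis by (intro exI[of _ m]) (simp add: *)
  qed
  moreover have "asign D \<circ> inv f = asign D'"
  proof
    fix i show "(asign D \<circ> inv f) i = asign D' i"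
      unfolding s[symmetric] using f by (simp add: bij_is_surj surj_f_inv_f)
  qed
  ultimately show ?thesis
    unfolding diagram_iso_def
    by (intro exI[of _ "inv f"] exI[of _ "inv p"]) (use f p in \<open>simp add: bij_imp_bij_inv\<close>)
qed

lemma diagram_iso_trans:
  assumes "diagram_iso D D'" "diagram_iso D' D''" shows "diagram_iso D D''"
proof -
  from assms(1) obtain f p where f: "bij f" and p: "bij p" and s: "asign D' \<circ> f = asign D"
    and c: "\<And>b. \<exists>n. circ D' (p b) = rotate n (map (rename_pt f) (circ D b))"
    unfolding diagram_iso_def by blast
  from assms(2) obtain g q where g: "bij g" and q: "bij q" and s': "asign D'' \<circ> g = asign D'"
    and c': "\<And>b. \<exists>n. circ D'' (q b) = rotate n (map (rename_pt g) (circ D' b))"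
    unfolding diagram_iso_def by blast
  have "\<exists>n. circ D'' ((q \<circ> p) b) = rotate n (map (rename_pt (g \<circ> f)) (circ D b))" for b
  proof -
    obtain n where n: "circ D' (p b) = rotate n (map (rename_pt f) (circ D b))" using c by blast
    obtain m where m: "circ D'' (q (p b)) = rotate m (map (rename_pt g) (circ D' (p b)))"
      using c' by blast
    show ?thesis
      by (rule exI[of _ "m + n"])
        (simp add: m n rotate_map rotate_rotate flip: rename_pt_comp)
  qed
  moreover have "asign D'' \<circ> (g \<circ> f) = asign D" using s s' by (simp add: o_assoc)
  ultimately show ?thesis
    unfolding diagram_iso_def
    by (intro exI[of _ "g \<circ> f"] exI[of _ "q \<circ> p"]) (use bij_comp[OF f g] bij_comp[OF p q] in simp)
qed

lemma gauss_diagram_finite: "gauss_diagram D \<Longrightarrow> finite (arrows D)"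
proof -
  assume "gauss_diagram D"
  then have "finite (arrows D \<times> (UNIV :: arrow_end set))"
    unfolding gauss_diagram_def by (metis List.finite_set)
  then show ?thesis by (auto dest: finite_cartesian_productD1)
qed

lemma arrows_keep [simp]: "arrows (keep S D) = arrows D \<inter> S"
  by (auto simp: arrows_def keep_def restrict_map_def split: if_splits)

lemma keep_keep: "T \<subseteq> S \<Longrightarrow> keep T (keep S D) = keep T D"
  by (auto simp: keep_def Int_absorb1 intro!: filter_cong arg_cong2[of _ _ _ _ Diagram])

lemma endpoints_keep: "endpoints (keep S D) b = filter (\<lambda>q. fst q \<in> S) (endpoints D b)"
  by (auto simp: endpoints_def keep_def filter_map endpoint_def o_def split_def)

lemma gauss_diagram_keep: "gauss_diagram D \<Longrightarrow> gauss_diagram (keep S D)"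
  unfolding gauss_diagram_def endpoints_keep arrows_keep
  by (simp flip: filter_append) auto

lemma locally_labeled_keep: "locally_labeled D \<Longrightarrow> locally_labeled (keep S D)"
  unfolding locally_labeled_def
  by (auto simp: gauss_diagram_keep) (auto simp: keep_def)

lemma diagram_iso_keep:
  assumes f: "bij f" and p: "bij p" and s: "asign D' \<circ> f = asign D"
    and c: "\<forall>b. \<exists>n. circ D' (p b) = rotate n (map (rename_pt f) (circ D b))"
  shows "diagram_iso (keep S D) (keep (f ` S) D')"
proof -
  have "\<exists>n. circ (keep (f ` S) D') (p b) = rotate n (map (rename_pt f) (circ (keep S D) b))" for b
  proof -
    obtain n where n: "circ D' (p b) = rotate n (map (rename_pt f) (circ D b))" using c by blast
    have *: "(\<lambda>q. fst q \<in> f ` S) \<circ> rename_pt f = (\<lambda>q :: 'a pt. fst q \<in> S)"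
      using f by (auto simp: fun_eq_iff bij_is_inj inj_image_mem_iff)
    show ?thesis
      using filter_rotate[of "\<lambda>q. fst q \<in> f ` S" n "map (rename_pt f) (circ D b)"]
      by (simp add: keep_def n filter_map *)
  qed
  moreover have "asign (keep (f ` S) D') \<circ> f = asign (keep S D)"
    using f by (auto simp: fun_eq_iff keep_def restrict_map_def bij_is_inj inj_image_mem_iff
        simp flip: s)
  ultimately show ?thesis
    unfolding diagram_iso_def by (intro exI[of _ f] exI[of _ p]) (simp add: f p)
qed


section \<open>The labeled arrow algebra\<close>

definition lgauss_rel :: "ldiagram \<Rightarrow> ldiagram \<Rightarrow> bool" where
  "lgauss_rel D D' \<longleftrightarrow> locally_labeled D \<and> locally_labeled D' \<and> diagram_iso D D'"

quotient_type lgauss = ldiagram / partial: lgauss_rel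
proof (rule part_equivpI)
  show "\<exists>D. lgauss_rel D D"
    by (rule exI[of _ "Diagram (\<lambda>_. []) Map.empty"])
      (simp add: lgauss_rel_def locally_labeled_def gauss_diagram_def endpoints_def arrows_def
        diagram_iso_refl)
  show "symp lgauss_rel"
    by (auto simp: symp_def lgauss_rel_def diagram_iso_sym)
  show "transp lgauss_rel"
    by (auto simp: transp_def lgauss_rel_def intro: diagram_iso_trans)
qed

type_synonym arrow_algebra = "lgauss \<Rightarrow>\<^sub>0 int"

lemma module_arrow_algebra: "module (frag_cmul :: int \<Rightarrow> arrow_algebra \<Rightarrow> arrow_algebra)"
  by unfold_locales (simp_all add: frag_cmul_distrib frag_cmul_distrib2)

lemma lgauss_rel_keep_sum:
  fixes c :: "nat \<Rightarrow> int"
  assumes "lgauss_rel D D'"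
  shows "(\<Sum>S \<in> Pow (arrows D).
            frag_cmul (c (card (arrows D - S))) (frag_of (abs_lgauss (keep S D)))) =
         (\<Sum>S \<in> Pow (arrows D').
            frag_cmul (c (card (arrows D' - S))) (frag_of (abs_lgauss (keep S D'))))"
proof -
  from assms obtain f p where f: "bij f" and p: "bij p" and s: "asign D' \<circ> f = asign D"
    and c: "\<forall>b. \<exists>n. circ D' (p b) = rotate n (map (rename_pt f) (circ D b))"
    unfolding lgauss_rel_def diagram_iso_def by blast
  have inj: "inj f" using f by (rule bij_is_inj)
  have A: "arrows D' = f ` arrows D"
  proof -
    have "arrows D = f -` arrows D'"
      by (auto simp: arrows_def dom_def vimage_def simp flip: s)
    then show ?thesis using f by (simp add: bij_is_surj surj_image_vimage_eq)
  qed
  show ?thesis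
  proof (rule sum.reindex_cong[of "image f" _ _ , symmetric])
    show "inj_on (image f) (Pow (arrows D))" using inj by (meson inj_image_eq_iff inj_onI)
    show "Pow (arrows D') = image f ` Pow (arrows D)" by (simp add: A image_Pow_surj)
    fix S assume "S \<in> Pow (arrows D)"
    have "lgauss_rel (keep S D) (keep (f ` S) D')"
      using assms diagram_iso_keep[OF f p s c] by (simp add: lgauss_rel_def locally_labeled_keep)
    then have "abs_lgauss (keep S D) = abs_lgauss (keep (f ` S) D')"
      by (metis Quotient3_lgauss Quotient3_rel)
    moreover have "card (arrows D' - f ` S) = card (arrows D - S)"
      using inj by (simp add: A card_image inj_on_subset flip: image_set_diff)
    ultimately show "frag_cmul (c (card (arrows D' - f ` S))) (frag_of (abs_lgauss (keep (f ` S) D')))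
        = frag_cmul (c (card (arrows D - S))) (frag_of (abs_lgauss (keep S D)))"
      by simp
  qed
qed

lift_definition degree :: "lgauss \<Rightarrow> nat" is "\<lambda>D. card (arrows D)"
proof -
  fix D D' assume "lgauss_rel D D'"
  then obtain f where f: "bij f" and s: "asign D' \<circ> f = asign D"
    unfolding lgauss_rel_def diagram_iso_def by blast
  have "arrows D = f -` arrows D'"
    by (auto simp: arrows_def dom_def vimage_def simp flip: s)
  then have "f ` arrows D = arrows D'" using f by (simp add: bij_is_surj surj_image_vimage_eq)
  then show "card (arrows D) = card (arrows D')"
    using f by (metis bij_is_inj card_image inj_on_subset subset_UNIV)
qed

text \<open>
  \<^term>\<open>frag_of D\<close> is the diagram with all arrows ordinary, \<open>dashed D\<close> the
  diagram with all arrows dashed, multiplied out. The coefficient of \<open>dashed D\<close> in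
  \<open>A\<close> with respect to the basis of dashed diagrams is the coefficient of \<open>D\<close>
  in \<open>dashed_coords A\<close>; see the lemmas \<open>dashed_coords_dashed\<close> and
  \<open>dashed_expansion\<close> below.
\<close>

lift_definition dashed :: "lgauss \<Rightarrow> arrow_algebra" is
  "\<lambda>D. \<Sum>S \<in> Pow (arrows D).
         frag_cmul ((-1) ^ card (arrows D - S)) (frag_of (abs_lgauss (keep S D)))"
  by (rule lgauss_rel_keep_sum)

lift_definition subdiagram_sum :: "lgauss \<Rightarrow> arrow_algebra" is
  "\<lambda>D. \<Sum>S \<in> Pow (arrows D). frag_of (abs_lgauss (keep S D))"
  using lgauss_rel_keep_sum[of _ _ "\<lambda>_. 1"] by simp

definition dashed_coords :: "arrow_algebra \<Rightarrow> arrow_algebra" where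
  "dashed_coords = frag_extend subdiagram_sum"

definition arrow_inner :: "arrow_algebra \<Rightarrow> arrow_algebra \<Rightarrow> int" where
  "arrow_inner A B =
     (\<Sum>D \<in> Poly_Mapping.keys (dashed_coords A).
        Poly_Mapping.lookup (dashed_coords A) D * Poly_Mapping.lookup (dashed_coords B) D)"

text \<open>Set all dashed diagrams with more than \<open>n\<close> arrows to zero.\<close>

definition truncate_algebra :: "nat \<Rightarrow> arrow_algebra \<Rightarrow> arrow_algebra" where
  "truncate_algebra n A =
     frag_extend (\<lambda>D. if degree D \<le> n then dashed D else 0) (dashed_coords A)"

lemma alternating_interval_sum:
  assumes A: "finite A" "T \<subseteq> A"
  shows "(\<Sum>S | S \<in> Pow A \<and> T \<subseteq> S. (-1) ^ card (A - S)) = (if T = A then 1 else (0 :: int))"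
    and "(\<Sum>S | S \<in> Pow A \<and> T \<subseteq> S. (-1) ^ card (S - T)) = (if T = A then 1 else (0 :: int))"
proof -
  let ?I = "{S. S \<in> Pow A \<and> T \<subseteq> S}"
  have sgn: "(-1) ^ card (V - U) = ((-1) ^ card V * (-1) ^ card U :: int)"
    if "finite V" "U \<subseteq> V" for U V :: "'a set"
  proof -
    have "card V = card (V - U) + card U"
      using that by (simp add: card_Diff_subset card_mono finite_subset)
    then show ?thesis by (simp add: power_add)
  qed
  have zero: "(\<Sum>S \<in> ?I. (-1) ^ card S) = (0 :: int)" if "T \<noteq> A"
  proof (rule sum_alternating_cancels)
    show "finite ?I" using A by simp
    show "card {S \<in> ?I. even (card S)} = card {S \<in> ?I. odd (card S)}"
      using card_subsupersets_even_odd[of A T] A that by (simp add: psubset_eq conj_assoc)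
  qed
  have one: "?I = {A}" if "T = A" using that by auto
  show "(\<Sum>S \<in> ?I. (-1) ^ card (A - S)) = (if T = A then 1 else (0 :: int))"
  proof (cases "T = A")
    case False
    have "(\<Sum>S \<in> ?I. (-1) ^ card (A - S)) = (\<Sum>S \<in> ?I. (-1) ^ card A * (-1) ^ card S :: int)"
      by (rule sum.cong) (use A in \<open>auto simp: sgn\<close>)
    with zero False show ?thesis by (simp flip: sum_distrib_left)
  next
    case True
    show ?thesis unfolding one[OF True] using True by simp
  qed
  show "(\<Sum>S \<in> ?I. (-1) ^ card (S - T)) = (if T = A then 1 else (0 :: int))"
  proof (cases "T = A")
    case False
    have "(\<Sum>S \<in> ?I. (-1) ^ card (S - T)) = (\<Sum>S \<in> ?I. (-1) ^ card S * (-1) ^ card T :: int)"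
      by (rule sum.cong) (use A in \<open>auto simp: sgn dest: finite_subset\<close>)
    with zero False show ?thesis by (simp flip: sum_distrib_right)
  next
    case True
    show ?thesis unfolding one[OF True] using True by simp
  qed
qed

lemma frag_cmul_sum_left:
  "frag_cmul (sum c I) x = (\<Sum>i \<in> I. frag_cmul (c i) x)"
  by (induction I rule: infinite_finite_induct) (auto simp: frag_cmul_distrib)

lemma moebius_subset_sum:
  fixes g :: "'a set \<Rightarrow> 'b \<Rightarrow>\<^sub>0 int"
  assumes A: "finite A"
  shows "(\<Sum>S \<in> Pow A. frag_cmul ((-1) ^ card (A - S)) (\<Sum>T \<in> Pow S. g T)) = g A" (is ?P)
    and "(\<Sum>S \<in> Pow A. \<Sum>T \<in> Pow S. frag_cmul ((-1) ^ card (S - T)) (g T)) = g A" (is ?Q)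
proof -
  have swap: "(\<Sum>S \<in> Pow A. \<Sum>T \<in> Pow S. frag_cmul (c S T) (g T)) = g A"
    if c: "\<And>T. T \<subseteq> A \<Longrightarrow> (\<Sum>S | S \<in> Pow A \<and> T \<subseteq> S. c S T) = (if T = A then 1 else 0)"
    for c :: "'a set \<Rightarrow> 'a set \<Rightarrow> int"
  proof -
    have "(\<Sum>S \<in> Pow A. \<Sum>T \<in> Pow S. frag_cmul (c S T) (g T)) =
          (\<Sum>S \<in> Pow A. \<Sum>T | T \<in> Pow A \<and> T \<subseteq> S. frag_cmul (c S T) (g T))"
      by (intro sum.cong) auto
    also have "\<dots> = (\<Sum>T \<in> Pow A. \<Sum>S | S \<in> Pow A \<and> T \<subseteq> S. frag_cmul (c S T) (g T))"
      using A by (intro sum.swap_restrict) auto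
    also have "\<dots> = (\<Sum>T \<in> Pow A. if T = A then g T else 0)"
      by (rule sum.cong) (use c in \<open>auto simp flip: frag_cmul_sum_left\<close>)
    also have "\<dots> = g A" using A by (simp add: sum.delta)
    finally show ?thesis .
  qed
  have "frag_cmul ((-1) ^ card (A - S)) (\<Sum>T \<in> Pow S. g T) =
        (\<Sum>T \<in> Pow S. frag_cmul ((-1) ^ card (A - S)) (g T))" if "S \<in> Pow A" for S
    by (rule frag_cmul_sum)
  then show ?P
    using swap[of "\<lambda>S T. (-1) ^ card (A - S)"] alternating_interval_sum(1)[OF A] by simp
  show ?Q
    using swap[of "\<lambda>S T. (-1) ^ card (S - T)"] alternating_interval_sum(2)[OF A] by simp
qed

lemma rep_lgauss_ex: "\<exists>P. D = abs_lgauss P \<and> lgauss_rel P P"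
  by (metis Quotient3_def Quotient3_lgauss)

lemma lgauss_rel_keep: "lgauss_rel P P \<Longrightarrow> lgauss_rel (keep S P) (keep S P)"
  by (simp add: lgauss_rel_def locally_labeled_keep diagram_iso_refl)

lemma lgauss_rel_finite: "lgauss_rel P P \<Longrightarrow> finite (arrows P)"
  by (simp add: lgauss_rel_def locally_labeled_def gauss_diagram_finite)

lemma keep_all:
  assumes "gauss_diagram P" shows "keep (arrows P) P = P"
proof (cases P)
  case (Diagram c s)
  have "fst q \<in> arrows P" if "q \<in> set (circ P b)" for q b
  proof -
    have "endpoint q \<in> set (endpoints P False @ endpoints P True)"
      using that by (cases b) (auto simp: endpoints_def)
    then have "endpoint q \<in> arrows P \<times> UNIV"
      using assms unfolding gauss_diagram_def by blast
    then show ?thesis by (auto simp: endpoint_def split: prod.splits)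
  qed
  then have "filter (\<lambda>q. fst q \<in> arrows P) (circ P b) = circ P b" for b
    by (simp add: filter_id_conv)
  moreover have "asign P |` arrows P = asign P"
    by (rule ext) (auto simp: arrows_def restrict_map_def domIff)
  ultimately show ?thesis by (simp add: keep_def)
qed

lemma subdiagram_sum_keep:
  assumes "lgauss_rel P P" "S \<subseteq> arrows P"
  shows "subdiagram_sum (abs_lgauss (keep S P)) = (\<Sum>T \<in> Pow S. frag_of (abs_lgauss (keep T P)))"
proof -
  have "subdiagram_sum (abs_lgauss (keep S P)) =
        (\<Sum>T \<in> Pow S. frag_of (abs_lgauss (keep T (keep S P))))"
    using assms by (simp add: subdiagram_sum.abs_eq lgauss_rel_keep Int_absorb1)
  then show ?thesis by (simp add: keep_keep)
qed

lemma dashed_keep: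
  assumes "lgauss_rel P P" "S \<subseteq> arrows P"
  shows "dashed (abs_lgauss (keep S P)) =
    (\<Sum>T \<in> Pow S. frag_cmul ((-1) ^ card (S - T)) (frag_of (abs_lgauss (keep T P))))"
proof -
  have "dashed (abs_lgauss (keep S P)) =
    (\<Sum>T \<in> Pow S. frag_cmul ((-1) ^ card (S - T)) (frag_of (abs_lgauss (keep T (keep S P)))))"
    using assms by (simp add: dashed.abs_eq lgauss_rel_keep Int_absorb1)
  then show ?thesis by (simp add: keep_keep)
qed

lemma dashed_coords_dashed [simp]: "dashed_coords (dashed D) = frag_of D"
proof -
  obtain P where D: "D = abs_lgauss P" and P: "lgauss_rel P P" using rep_lgauss_ex by blast
  let ?A = "arrows P" and ?k = "\<lambda>S. frag_of (abs_lgauss (keep S P))"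
  have fin: "finite ?A" using P by (rule lgauss_rel_finite)
  have "dashed_coords (dashed D) =
        (\<Sum>S \<in> Pow ?A. frag_cmul ((-1) ^ card (?A - S)) (subdiagram_sum (abs_lgauss (keep S P))))"
    using fin by (simp add: D dashed.abs_eq[OF P] dashed_coords_def frag_extend_sum
        frag_extend_cmul o_def)
  also have "\<dots> = (\<Sum>S \<in> Pow ?A. frag_cmul ((-1) ^ card (?A - S)) (\<Sum>T \<in> Pow S. ?k T))"
    using P by (simp add: subdiagram_sum_keep)
  also have "\<dots> = ?k ?A" using moebius_subset_sum(1)[OF fin] .
  finally show ?thesis using P by (simp add: D keep_all lgauss_rel_def locally_labeled_def)
qed

lemma frag_of_eq_dashed_sum:
  assumes P: "lgauss_rel P P"
  shows "frag_of (abs_lgauss P) = (\<Sum>S \<in> Pow (arrows P). dashed (abs_lgauss (keep S P)))"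
proof -
  have "(\<Sum>S \<in> Pow (arrows P). dashed (abs_lgauss (keep S P))) =
        frag_of (abs_lgauss (keep (arrows P) P))"
    using moebius_subset_sum(2)[OF lgauss_rel_finite[OF P]] P by (simp add: dashed_keep)
  then show ?thesis using P by (simp add: keep_all lgauss_rel_def locally_labeled_def)
qed

lemma dashed_expansion: "frag_extend dashed (dashed_coords A) = A"
proof -
  have gen: "frag_extend dashed (subdiagram_sum D) = frag_of D" for D
  proof -
    obtain P where D: "D = abs_lgauss P" and P: "lgauss_rel P P" using rep_lgauss_ex by blast
    show ?thesis
      using lgauss_rel_finite[OF P]
      by (simp add: D subdiagram_sum.abs_eq[OF P] frag_extend_sum o_def
          frag_of_eq_dashed_sum[OF P])
  qed
  have "Poly_Mapping.keys A \<subseteq> UNIV" by simp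
  then show ?thesis
    unfolding dashed_coords_def
    by (induction A rule: frag_induction) (simp_all add: gen frag_extend_diff)
qed

lemma dashed_orthonormal: "arrow_inner (dashed D) (dashed D') = (if D = D' then 1 else 0)"
  by (simp add: arrow_inner_def)


section \<open>Reidemeister moves and the Polyak algebra\<close>

text \<open>\<open>q\<close> comes right after \<open>p\<close> on a circle, in the cyclic order.\<close>

definition adjacent :: "'l diagram \<Rightarrow> 'l pt \<Rightarrow> 'l pt \<Rightarrow> bool" where
  "adjacent D p q \<longleftrightarrow> (\<exists>b n r. rotate n (circ D b) = p # q # r)"

text \<open>
  Virtual moves do not change the Gauss diagram. In each of the moves below, all crossing points
  on one strand carry the label of that strand.
\<close>

definition reidemeister1 :: "ldiagram \<Rightarrow> ldiagram \<Rightarrow> bool" where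
  "reidemeister1 D D' \<longleftrightarrow>
     (\<exists>i e e' x. e \<noteq> e' \<and> adjacent D' (i, e, x, x) (i, e', x, x) \<and> D = keep (- {i}) D')"

definition reidemeister2 :: "ldiagram \<Rightarrow> ldiagram \<Rightarrow> bool" where
  "reidemeister2 D D' \<longleftrightarrow>
     (\<exists>i j x y. asign D' i \<noteq> asign D' j \<and>
        adjacent D' (i, Tail, x, x) (j, Tail, x, x) \<and>
        (adjacent D' (i, Head, y, y) (j, Head, y, y) \<or>
         adjacent D' (j, Head, y, y) (i, Head, y, y)) \<and>
        D = keep (- {i, j}) D')"

text \<open>
  In a third move, \<open>i\<close> goes from the top to the middle strand, \<open>j\<close> from the top to the
  bottom one and \<open>k\<close> from the middle to the bottom one. For three oriented lines in the plane
  the crossing of an over-line of direction \<open>o\<close> and an under-line of direction \<open>v\<close> has the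
  sign of \<open>det(o, v)\<close>, and comparing the positions of the three intersection points shows that
  the signs determine the orders of the crossing points on the lines up to the simultaneous
  reversal \<open>\<sigma>\<close>. All 16 cases occur; they form the 8 oriented third moves, each in both
  directions.
\<close>

definition ordered_adjacent :: "'l diagram \<Rightarrow> int \<Rightarrow> 'l pt \<Rightarrow> 'l pt \<Rightarrow> bool" where
  "ordered_adjacent D s p q \<longleftrightarrow> (if s = 1 then adjacent D p q else adjacent D q p)"

definition reidemeister3 :: "ldiagram \<Rightarrow> ldiagram \<Rightarrow> bool" where
  "reidemeister3 D D' \<longleftrightarrow>
     (\<exists>i j k \<epsilon>i \<epsilon>j \<epsilon>k \<sigma> x y z.
        distinct [i, j, k] \<and> \<sigma> \<in> {1, -1} \<and>
        map (asign D) [i, j, k] = [Some \<epsilon>i, Some \<epsilon>j, Some \<epsilon>k] \<and>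
        ordered_adjacent D (\<sigma> * csign_val \<epsilon>i * csign_val \<epsilon>j * csign_val \<epsilon>k)
          (i, Tail, x, x) (j, Tail, x, x) \<and>
        ordered_adjacent D (\<sigma> * csign_val \<epsilon>i) (i, Head, y, y) (k, Tail, y, y) \<and>
        ordered_adjacent D (\<sigma> * csign_val \<epsilon>j) (j, Head, z, z) (k, Head, z, z) \<and>
        D' = Diagram
          (\<lambda>b. map (transpose (i, Tail, x, x) (j, Tail, x, x) \<circ>
                    transpose (i, Head, y, y) (k, Tail, y, y) \<circ>
                    transpose (j, Head, z, z) (k, Head, z, z)) (circ D b))
          (asign D))"

definition reidemeister_differences :: "arrow_algebra set" where
  "reidemeister_differences =
     {frag_of (abs_lgauss D) - frag_of (abs_lgauss D') | D D'.
        locally_labeled D \<and> locally_labeled D' \<and>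
        (reidemeister1 D D' \<or> reidemeister2 D D' \<or> reidemeister3 D D')}"

definition polyak_algebra :: "arrow_algebra set" where
  "polyak_algebra =
     {A. \<forall>R \<in> module.span frag_cmul reidemeister_differences. arrow_inner A R = 0}"

text \<open>
  This is the orthogonal complement of the relations inside the arrow algebra in which the
  diagrams with more than \<open>n\<close> arrows have been set to zero (identified with the span of the
  dashed diagrams with at most \<open>n\<close> arrows). It is contained in the image of the Polyak algebra
  under \<^term>\<open>truncate_algebra n\<close>.
\<close>

definition truncated_polyak_algebra :: "nat \<Rightarrow> arrow_algebra set" where
  "truncated_polyak_algebra n = {A \<in> polyak_algebra. truncate_algebra n A = A}"


section \<open>The enhanced invariant\<close>

text \<open>
  Laurent polynomials in \<open>u\<close> with integer coefficients form the group ring of the integers.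
\<close>

type_synonym laurent = "int \<Rightarrow>\<^sub>0 int"

definition u_pow :: "int \<Rightarrow> laurent" where
  "u_pow n = Poly_Mapping.single n 1"

definition enhanced_invariant :: "arrow_algebra \<Rightarrow> 'l diagram \<Rightarrow> laurent" where
  "enhanced_invariant A K =
     (\<Sum>\<phi> \<in> labelings K. u_pow (arrow_inner A (frag_of (abs_lgauss (labeled_diagram K \<phi>)))))"

definition one_arrow :: "csign \<Rightarrow> X1 \<Rightarrow> X1 \<Rightarrow> ldiagram" where
  "one_arrow \<epsilon> a b =
     Diagram (\<lambda>c. if c then [(0, Head, b, b)] else [(0, Tail, a, a)]) [0 \<mapsto> \<epsilon>]"

definition L_element :: arrow_algebra where
  "L_element =
     (\<Sum>(a, b) \<in> {(x1, x2), (x2, x1)}.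
        dashed (abs_lgauss (one_arrow Pos a b)) - dashed (abs_lgauss (one_arrow Neg a b)))"

end

(*
  Pairing with L_element turns a locally labeled diagram D into the sum of the signs of the arrows
  of D that join the two circles and carry different labels at tail and head: the single-arrow
  subdiagrams of D isomorphic to a summand of L_element are exactly the ones spanned by these
  arrows. That signed count only depends on the sets of crossing points on the circles and
  on the signs; the first move adds an arrow that is not counted, having both ends on one circle,
  the second one adds two arrows of opposite signs with equal labels, whose contributions cancel,
  and the third one keeps the sets of crossing points and the signs. A labeling by
  the trivial biquandle is a choice of one label per circle, and the count is zero for the
  two constant choices and twice the linking number for the two others.
*)
theory Submission
  imports Defs
begin

section \<open>The signed count of mixed arrows\<close>

text \<open>Only membership in the circles enters, not position, so a rearrangement of the points
  within a circle is invisible here. The quantified \<open>c\<close> makes the notion symmetric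
  under exchanging the circles.\<close>

definition joins :: "('l \<times> 'l) diagram \<Rightarrow> nat \<Rightarrow> 'l \<Rightarrow> 'l \<Rightarrow> bool" where
  "joins D i a b \<longleftrightarrow>
     (\<exists>c. (i, Tail, a, a) \<in> set (circ D c) \<and> (i, Head, b, b) \<in> set (circ D (\<not> c)))"

definition mixed_arrows :: "('l \<times> 'l) diagram \<Rightarrow> nat set" where
  "mixed_arrows D = {i \<in> arrows D. \<exists>a b. a \<noteq> b \<and> joins D i a b}"

definition mixed_sign_sum :: "('l \<times> 'l) diagram \<Rightarrow> int" where
  "mixed_sign_sum D = (\<Sum>i \<in> mixed_arrows D. csign_val (the (asign D i)))"

text \<open>Distinctness of the concatenated endpoint lists works both across the circles and within
  one. It follows that an endpoint determines its circle and its decoration.\<close>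

lemma crossing_point_unique:
  assumes "gauss_diagram D" "q \<in> set (circ D c)" "q' \<in> set (circ D c')"
    and "endpoint q = endpoint q'"
  shows "c = c'" "q = q'"
proof -
  have d: "distinct (endpoints D False @ endpoints D True)"
    using assms(1) by (simp add: gauss_diagram_def)
  have "endpoint q \<in> set (endpoints D c)" using assms(2) by (simp add: endpoints_def)
  moreover have "endpoint q \<in> set (endpoints D c')"
    unfolding assms(4) using assms(3) by (simp add: endpoints_def)
  ultimately show c: "c = c'" using d by (cases c; cases c') auto
  have "inj_on endpoint (set (circ D c))"
    using d by (cases c) (auto simp: endpoints_def distinct_map)
  then show "q = q'" using assms(2-4) c by (auto dest: inj_onD)
qed

lemma distinct_circ: "gauss_diagram D \<Longrightarrow> distinct (circ D c)"
  by (cases c) (auto simp: gauss_diagram_def endpoints_def distinct_map)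

lemma crossing_point_arrow:
  assumes "gauss_diagram D" "(i, l) \<in> set (circ D c)"
  shows "i \<in> arrows D"
proof -
  have "endpoint (i, l) \<in> set (endpoints D False @ endpoints D True)"
    using assms(2) by (cases c) (auto simp: endpoints_def)
  then show ?thesis
    using assms(1) by (auto simp: gauss_diagram_def endpoint_def split: prod.splits)
qed

text \<open>This prevents an arrow from being counted under both label pairs of
  \<open>L_element\<close>.\<close>

lemma joins_unique:
  assumes "gauss_diagram D" "joins D i a b" "joins D i a' b'"
  shows "a = a' \<and> b = b'"
  using assms(2,3) crossing_point_unique(2)[OF assms(1)]
  by (fastforce simp: joins_def endpoint_def)

lemma joins_keep: "joins (keep S D) i a b \<longleftrightarrow> i \<in> S \<and> joins D i a b"
  by (auto simp: joins_def keep_def)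

lemma finite_mixed_arrows: "gauss_diagram D \<Longrightarrow> finite (mixed_arrows D)"
  by (simp add: mixed_arrows_def gauss_diagram_finite)

lemma mixed_arrows_keep: "mixed_arrows (keep S D) = mixed_arrows D \<inter> S"
  by (auto simp: mixed_arrows_def joins_keep)

lemma mixed_sign_sum_keep:
  "mixed_sign_sum (keep S D) = (\<Sum>i \<in> mixed_arrows D \<inter> S. csign_val (the (asign D i)))"
  unfolding mixed_sign_sum_def mixed_arrows_keep by (simp add: keep_def)

section \<open>Invariance of the signed count under the three Reidemeister moves\<close>

lemma adjacent_same_circle:
  assumes "adjacent D p q"
  obtains c where "p \<in> set (circ D c)" "q \<in> set (circ D c)"
proof -
  obtain c n r where "rotate n (circ D c) = p # q # r"
    using assms by (auto simp: adjacent_def)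
  then have "set (circ D c) = set (p # q # r)" by (metis set_rotate)
  then show ?thesis using that by auto
qed

lemma adjacent_mem_iff:
  assumes "gauss_diagram D" "adjacent D p q \<or> adjacent D q p"
  shows "p \<in> set (circ D c) \<longleftrightarrow> q \<in> set (circ D c)"
proof -
  obtain d where "p \<in> set (circ D d)" "q \<in> set (circ D d)"
    using assms(2) by (metis adjacent_same_circle)
  then show ?thesis using crossing_point_unique(1)[OF assms(1) _ _ refl] by blast
qed

lemma reidemeister1_mixed_sign_sum:
  assumes "gauss_diagram D'" "reidemeister1 D D'"
  shows "mixed_sign_sum D = mixed_sign_sum D'"
proof -
  obtain i e e' x where e: "e \<noteq> e'" and adj: "adjacent D' (i, e, x, x) (i, e', x, x)"
    and D: "D = keep (- {i}) D'"
    using assms(2) unfolding reidemeister1_def by blast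
  obtain c where c: "(i, e, x, x) \<in> set (circ D' c)" "(i, e', x, x) \<in> set (circ D' c)"
    using adj adjacent_same_circle by blast
  \<comment> \<open>\<open>arrow_end\<close> has just two values, so \<open>e\<close> and
    \<open>e'\<close> are the tail and the head of \<open>i\<close> in some order, and both ends of
    \<open>i\<close> lie on \<open>c\<close>.\<close>
  have "\<exists>y. (i, t, y, y) \<in> set (circ D' c)" for t
    using c e by (cases t; cases e; cases e') auto
  then obtain y z where yz: "(i, Tail, y, y) \<in> set (circ D' c)" "(i, Head, z, z) \<in> set (circ D' c)"
    by blast
  have "\<not> joins D' i a b" for a b
  proof
    assume "joins D' i a b"
    then obtain d where d: "(i, Tail, a, a) \<in> set (circ D' d)" "(i, Head, b, b) \<in> set (circ D' (\<not> d))"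
      by (auto simp: joins_def)
    have "d = c" using crossing_point_unique(1)[OF assms(1) d(1) yz(1)] by (simp add: endpoint_def)
    moreover have "(\<not> d) = c"
      using crossing_point_unique(1)[OF assms(1) d(2) yz(2)] by (simp add: endpoint_def)
    ultimately show False by simp
  qed
  then have "mixed_arrows D' \<inter> - {i} = mixed_arrows D'"
    by (auto simp: mixed_arrows_def)
  then show ?thesis
    unfolding D mixed_sign_sum_keep by (simp add: mixed_sign_sum_def)
qed

text \<open>The two tails share a circle and a label, and so do the two heads. Hence both arrows are
  counted or neither is, and opposite signs cancel.\<close>

lemma reidemeister2_mixed_sign_sum:
  assumes g: "gauss_diagram D'" and "reidemeister2 D D'"
  shows "mixed_sign_sum D = mixed_sign_sum D'"
proof -
  obtain i j x y where s: "asign D' i \<noteq> asign D' j"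
    and t: "adjacent D' (i, Tail, x, x) (j, Tail, x, x)"
    and h: "adjacent D' (i, Head, y, y) (j, Head, y, y) \<or>
            adjacent D' (j, Head, y, y) (i, Head, y, y)"
    and D: "D = keep (- {i, j}) D'"
    using assms(2) unfolding reidemeister2_def by blast
  have it: "\<exists>c. (i, Tail, x, x) \<in> set (circ D' c)" and ih: "\<exists>c. (i, Head, y, y) \<in> set (circ D' c)"
    and jt: "\<exists>c. (j, Tail, x, x) \<in> set (circ D' c)" and jh: "\<exists>c. (j, Head, y, y) \<in> set (circ D' c)"
    using t h by (metis adjacent_same_circle)+
  \<comment> \<open>The decorations at the ends are fixed by the endpoints, so \<open>x\<close> and
    \<open>y\<close> are the only labels to compare.\<close>
  have joins_xy: "a = x \<and> b = y"
    if "joins D' k a b" "\<exists>c. (k, Tail, x, x) \<in> set (circ D' c)"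
      "\<exists>c. (k, Head, y, y) \<in> set (circ D' c)" for k a b
    using that crossing_point_unique(2)[OF g] by (fastforce simp: joins_def endpoint_def)
  have "joins D' i x y \<longleftrightarrow> joins D' j x y"
    unfolding joins_def using adjacent_mem_iff[OF g disjI1, OF t] adjacent_mem_iff[OF g h] by simp
  then have mem: "i \<in> mixed_arrows D' \<longleftrightarrow> j \<in> mixed_arrows D'"
    using joins_xy[OF _ it ih] joins_xy[OF _ jt jh] it jt crossing_point_arrow[OF g]
    unfolding mixed_arrows_def by blast
  \<comment> \<open>The move only says that two optional signs differ. Since both names are arrows,
    neither is \<open>None\<close>, so the signs are opposite.\<close>
  have "i \<in> arrows D'" "j \<in> arrows D'" using it jt crossing_point_arrow[OF g] by blast+
  then obtain \<epsilon> \<delta> where "asign D' i = Some \<epsilon>" "asign D' j = Some \<delta>"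
    by (auto simp: arrows_def)
  with s have cancel: "csign_val (the (asign D' i)) + csign_val (the (asign D' j)) = 0"
    by (cases \<epsilon>; cases \<delta>) auto
  have "i \<noteq> j" using s by auto
  let ?f = "\<lambda>i. csign_val (the (asign D' i))"
  have "mixed_sign_sum D' = sum ?f (mixed_arrows D' \<inter> - {i, j}) + sum ?f (mixed_arrows D' \<inter> {i, j})"
    unfolding mixed_sign_sum_def using finite_mixed_arrows[OF g]
    by (subst sum.union_disjoint[symmetric]) (auto intro!: sum.cong)
  moreover have "sum ?f (mixed_arrows D' \<inter> {i, j}) = 0"
  proof (cases "i \<in> mixed_arrows D'")
    case True
    then have "mixed_arrows D' \<inter> {i, j} = {i, j}" using mem by auto
    then show ?thesis using cancel \<open>i \<noteq> j\<close> by simp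
  next
    case False
    then have "mixed_arrows D' \<inter> {i, j} = {}" using mem by auto
    then show ?thesis by simp
  qed
  ultimately show ?thesis unfolding D mixed_sign_sum_keep by simp
qed

text \<open>In a third move, each swapped pair lies on one circle, so this applies to the set of
  points of every circle.\<close>

lemma transpose_image_eq:
  assumes "p \<in> A \<longleftrightarrow> q \<in> A" shows "transpose p q ` A = A"
  using assms by (cases "p \<in> A") (auto simp: transpose_def image_iff)

lemma reidemeister3_mixed_sign_sum:
  assumes g: "gauss_diagram D" and "reidemeister3 D D'"
  shows "mixed_sign_sum D = mixed_sign_sum D'"
proof -
  obtain i j k \<epsilon>i \<epsilon>j \<epsilon>k \<sigma> x y z where
    adj: "ordered_adjacent D (\<sigma> * csign_val \<epsilon>i * csign_val \<epsilon>j * csign_val \<epsilon>k)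
          (i, Tail, x, x) (j, Tail, x, x)"
        "ordered_adjacent D (\<sigma> * csign_val \<epsilon>i) (i, Head, y, y) (k, Tail, y, y)"
        "ordered_adjacent D (\<sigma> * csign_val \<epsilon>j) (j, Head, z, z) (k, Head, z, z)"
    and D': "D' = Diagram
          (\<lambda>b. map (transpose (i, Tail, x, x) (j, Tail, x, x) \<circ>
                    transpose (i, Head, y, y) (k, Tail, y, y) \<circ>
                    transpose (j, Head, z, z) (k, Head, z, z)) (circ D b))
          (asign D)"
    using assms(2) unfolding reidemeister3_def by blast
  have iff: "p \<in> set (circ D c) \<longleftrightarrow> q \<in> set (circ D c)" if "ordered_adjacent D s p q" for s p q c
    using that adjacent_mem_iff[OF g] by (auto simp: ordered_adjacent_def split: if_splits)
  have "set (circ D' c) =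
      transpose (i, Tail, x, x) (j, Tail, x, x) `
        transpose (i, Head, y, y) (k, Tail, y, y) `
          transpose (j, Head, z, z) (k, Head, z, z) ` set (circ D c)" for c
    unfolding D' by (simp add: image_image)
  \<comment> \<open>The swaps are removed from the innermost outwards: each leaves
    \<open>set (circ D c)\<close> behind, to which the next one applies.\<close>
  then have "set (circ D' c) = set (circ D c)" for c
    by (simp only: transpose_image_eq[OF iff[OF adj(1)]] transpose_image_eq[OF iff[OF adj(2)]]
        transpose_image_eq[OF iff[OF adj(3)]])
  moreover have "asign D' = asign D" by (simp add: D')
  ultimately show ?thesis
    by (simp add: mixed_sign_sum_def mixed_arrows_def joins_def arrows_def)
qed


section \<open>Bilinearity of the inner product\<close>

lemma dashed_coords_diff: "dashed_coords (A - B) = dashed_coords A - dashed_coords B"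
  by (simp add: dashed_coords_def frag_extend_diff)

lemma dashed_coords_add: "dashed_coords (A + B) = dashed_coords A + dashed_coords B"
  by (simp add: dashed_coords_def frag_extend_add)

lemma dashed_coords_cmul: "dashed_coords (frag_cmul c A) = frag_cmul c (dashed_coords A)"
  by (simp add: dashed_coords_def frag_extend_cmul)

text \<open>The index set of \<open>arrow_inner\<close> is the support of its left argument.
  Additivity on the left therefore needs a common finite index set, padded with zero terms.\<close>

lemma arrow_inner_superset:
  assumes "finite S" "Poly_Mapping.keys (dashed_coords A) \<subseteq> S"
  shows "arrow_inner A B =
    (\<Sum>D \<in> S. Poly_Mapping.lookup (dashed_coords A) D * Poly_Mapping.lookup (dashed_coords B) D)"
  unfolding arrow_inner_def using assms
  by (intro sum.mono_neutral_left) (auto simp: in_keys_iff)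

lemma arrow_inner_add_left: "arrow_inner (A + B) C = arrow_inner A C + arrow_inner B C"
proof -
  let ?S = "Poly_Mapping.keys (dashed_coords A) \<union> Poly_Mapping.keys (dashed_coords B)"
  have "Poly_Mapping.keys (dashed_coords (A + B)) \<subseteq> ?S"
    by (simp add: dashed_coords_add Poly_Mapping.keys_add)
  then show ?thesis
    by (simp add: arrow_inner_superset[of ?S] dashed_coords_add lookup_add algebra_simps
        sum.distrib)
qed

lemma arrow_inner_diff_left: "arrow_inner (A - B) C = arrow_inner A C - arrow_inner B C"
  using arrow_inner_add_left[of "A - B" B C] by simp

lemma arrow_inner_add_right: "arrow_inner A (B + C) = arrow_inner A B + arrow_inner A C"
  by (simp add: arrow_inner_def dashed_coords_add lookup_add algebra_simps sum.distrib)

lemma arrow_inner_diff_right: "arrow_inner A (B - C) = arrow_inner A B - arrow_inner A C"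
  using arrow_inner_add_right[of A "B - C" C] by simp

lemma arrow_inner_cmul_right: "arrow_inner A (frag_cmul c B) = c * arrow_inner A B"
  by (simp add: arrow_inner_def dashed_coords_cmul sum_distrib_left mult_ac)

lemma arrow_inner_zero_right: "arrow_inner A 0 = 0"
  by (simp add: arrow_inner_def dashed_coords_def)

text \<open>Orthonormality: pairing with a basis element reads off its coordinate.\<close>

lemma arrow_inner_dashed: "arrow_inner (dashed D) B = Poly_Mapping.lookup (dashed_coords B) D"
  by (simp add: arrow_inner_def)


section \<open>The pairing with single-arrow diagrams\<close>

lemma distinct_set_singleton: "distinct xs \<Longrightarrow> set xs = {x} \<Longrightarrow> xs = [x]"
  by (cases xs) (auto, metis list.set_intros(1) neq_Nil_conv singletonD subsetD)

lemma arrows_one_arrow: "arrows (one_arrow \<epsilon> a b) = {0}"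
  by (simp add: one_arrow_def arrows_def)

lemma locally_labeled_one_arrow: "locally_labeled (one_arrow \<epsilon> a b)"
proof -
  have "(UNIV :: arrow_end set) = {Tail, Head}" using arrow_end.exhaust by blast
  then show ?thesis
    unfolding locally_labeled_def gauss_diagram_def arrows_one_arrow
    by (auto simp: endpoints_def endpoint_def one_arrow_def split: if_splits)
qed

lemma abs_lgauss_eq_iff:
  assumes "locally_labeled D" "locally_labeled D'"
  shows "abs_lgauss D = abs_lgauss D' \<longleftrightarrow> diagram_iso D D'"
  using Quotient3_rel[OF Quotient3_lgauss, of D D'] assms
  by (simp add: lgauss_rel_def diagram_iso_refl)

text \<open>An arrow has only two ends, and the end \<open>e'\<close> lies on the other circle, so
  \<open>e\<close> alone is left on \<open>c\<close>.\<close>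

lemma filter_circ_eq_singleton:
  assumes g: "gauss_diagram D" and q: "(i, e, l) \<in> set (circ D c)"
    and q': "(i, e', l') \<in> set (circ D (\<not> c))" and "e \<noteq> e'"
  shows "filter (\<lambda>q. fst q = i) (circ D c) = [(i, e, l)]"
proof (rule distinct_set_singleton)
  show "distinct (filter (\<lambda>q. fst q = i) (circ D c))" by (simp add: distinct_circ[OF g])
  have "r = (i, e, l)" if r: "r \<in> set (circ D c)" "fst r = i" for r
  proof -
    obtain t m where rt: "r = (i, t, m)" using r(2) by (cases r) auto
    have "t \<noteq> e'"
      using crossing_point_unique(1)[OF g r(1) q'] by (auto simp: rt endpoint_def)
    then have "t = e" using \<open>e \<noteq> e'\<close> by (cases t; cases e; cases e') auto
    then show ?thesis using crossing_point_unique(2)[OF g r(1) q] by (simp add: rt endpoint_def)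
  qed
  then have "{r \<in> set (circ D c). fst r = i} \<subseteq> {(i, e, l)}" by blast
  then show "set (filter (\<lambda>q. fst q = i) (circ D c)) = {(i, e, l)}" using q by auto
qed

text \<open>The signs carried along an isomorphism determine \<open>S\<close>, and its action on the
  circles determines the ends and their labels. Conversely, a joining arrow yields an explicit
  isomorphism.\<close>

lemma one_arrow_iso_keep_iff:
  assumes g: "gauss_diagram D" and S: "S \<subseteq> arrows D"
  shows "diagram_iso (one_arrow \<epsilon> a b) (keep S D) \<longleftrightarrow>
         (\<exists>i. S = {i} \<and> asign D i = Some \<epsilon> \<and> joins D i a b)"
proof
  assume "diagram_iso (one_arrow \<epsilon> a b) (keep S D)"
  then obtain f p where f: "bij f" and p: "bij p"
    and s: "asign (keep S D) \<circ> f = asign (one_arrow \<epsilon> a b)"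
    and c: "\<And>c. \<exists>n. circ (keep S D) (p c) =
              rotate n (map (rename_pt f) (circ (one_arrow \<epsilon> a b) c))"
    unfolding diagram_iso_def by blast
  define i where "i = f 0"
  have sf: "asign (keep S D) (f k) = (if k = 0 then Some \<epsilon> else None)" for k
    using fun_cong[OF s, of k] by (simp add: one_arrow_def)
  have i: "i \<in> S" "asign D i = Some \<epsilon>"
    using sf[of 0] by (auto simp: i_def keep_def restrict_map_def split: if_splits)
  \<comment> \<open>By surjectivity every name is some \<open>f k\<close>. Names in \<open>S\<close>
    carry a sign, and only \<open>f 0\<close> does so in \<open>keep S D\<close>.\<close>
  have "j = i" if "j \<in> S" for j
  proof -
    obtain k where k: "j = f k" using f by (metis bij_pointE)
    have "asign (keep S D) j \<noteq> None"
      using that S by (auto simp: keep_def arrows_def)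
    then show ?thesis using sf[of k] by (auto simp: k i_def split: if_splits)
  qed
  then have "S = {i}" using i by blast
  moreover have "joins D i a b"
  proof -
    have "p True = (\<not> p False)" using p by (metis (full_types) bij_def inj_eq)
    moreover have "circ (keep S D) (p False) = [(i, Tail, a, a)]"
      "circ (keep S D) (p True) = [(i, Head, b, b)]"
      using c[of False] c[of True] by (auto simp: one_arrow_def rename_pt_def i_def)
    ultimately have "(i, Tail, a, a) \<in> set (circ (keep S D) (p False)) \<and>
        (i, Head, b, b) \<in> set (circ (keep S D) (\<not> p False))"
      by simp
    then show ?thesis unfolding joins_def by (auto simp: keep_def)
  qed
  ultimately show "\<exists>i. S = {i} \<and> asign D i = Some \<epsilon> \<and> joins D i a b" using i by blast
next
  assume "\<exists>i. S = {i} \<and> asign D i = Some \<epsilon> \<and> joins D i a b"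
  then obtain i c where Si: "S = {i}" and s: "asign D i = Some \<epsilon>"
    and t: "(i, Tail, a, a) \<in> set (circ D c)" and h: "(i, Head, b, b) \<in> set (circ D (\<not> c))"
    by (auto simp: joins_def)
  \<comment> \<open>\<open>one_arrow\<close> has its tail on circle \<open>False\<close> and its
    head on \<open>True\<close>; \<open>?p\<close> sends these to \<open>c\<close> and the opposite
    circle. The renaming has to be a bijection of all names, hence the transposition of
    \<open>0\<close> and \<open>i\<close>.\<close>
  let ?p = "\<lambda>d. if d then \<not> c else c"
  have "bij ?p" by (rule involuntory_imp_bij) (cases c, auto)
  moreover have "asign (keep S D) \<circ> transpose 0 i = asign (one_arrow \<epsilon> a b)"
    by (rule ext) (auto simp: keep_def one_arrow_def Si s transpose_def restrict_map_def)
  moreover have "circ (keep S D) (?p d) =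
      rotate 0 (map (rename_pt (transpose 0 i)) (circ (one_arrow \<epsilon> a b) d))" for d
    using filter_circ_eq_singleton[OF g t h] filter_circ_eq_singleton[OF g h] t
    by (simp add: keep_def one_arrow_def Si rename_pt_def)
  ultimately show "diagram_iso (one_arrow \<epsilon> a b) (keep S D)"
    unfolding diagram_iso_def
    by (intro exI[of _ "transpose 0 i"] exI[of _ ?p] conjI allI exI[of _ "0 :: nat"]) simp_all
qed

text \<open>The pairing is a coefficient of \<open>subdiagram_sum\<close>: it counts the subsets of
  arrows whose subdiagram is isomorphic to the given one-arrow diagram.\<close>

lemma arrow_inner_one_arrow:
  assumes D: "locally_labeled D"
  shows "arrow_inner (dashed (abs_lgauss (one_arrow \<epsilon> a b))) (frag_of (abs_lgauss D)) =
    (\<Sum>i \<in> arrows D. if asign D i = Some \<epsilon> \<and> joins D i a b then 1 else 0)"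
proof -
  have rel: "lgauss_rel D D" using D by (simp add: lgauss_rel_def diagram_iso_refl)
  have g: "gauss_diagram D" using D by (simp add: locally_labeled_def)
  have fin: "finite (arrows D)" using g by (rule gauss_diagram_finite)
  let ?P = "\<lambda>i. asign D i = Some \<epsilon> \<and> joins D i a b"
  have eq: "abs_lgauss (one_arrow \<epsilon> a b) = abs_lgauss (keep S D) \<longleftrightarrow> (\<exists>i. S = {i} \<and> ?P i)"
    if "S \<subseteq> arrows D" for S
    using abs_lgauss_eq_iff[OF locally_labeled_one_arrow locally_labeled_keep[OF D]]
      one_arrow_iso_keep_iff[OF g that] by metis
  have "arrow_inner (dashed (abs_lgauss (one_arrow \<epsilon> a b))) (frag_of (abs_lgauss D)) =
      (\<Sum>S \<in> Pow (arrows D).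
         if abs_lgauss (one_arrow \<epsilon> a b) = abs_lgauss (keep S D) then 1 else 0)"
    by (simp add: arrow_inner_dashed dashed_coords_def subdiagram_sum.abs_eq[OF rel] lookup_sum)
  also have "\<dots> = (\<Sum>S \<in> Pow (arrows D). if \<exists>i. S = {i} \<and> ?P i then 1 else 0)"
    by (rule sum.cong[OF refl]) (simp only: eq Pow_iff)
  \<comment> \<open>Only singletons contribute, so the sum over subsets becomes a sum over
    arrows.\<close>
  also have "\<dots> = (\<Sum>S \<in> (\<lambda>i. {i}) ` arrows D. if \<exists>i. S = {i} \<and> ?P i then 1 else 0)"
    using fin by (intro sum.mono_neutral_right) auto
  also have "\<dots> = (\<Sum>i \<in> arrows D. if ?P i then 1 else 0)"
    by (subst sum.reindex) auto
  finally show ?thesis .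
qed

section \<open>Pairing with \<open>L_element\<close> and its membership in the truncated Polyak
  algebra\<close>

lemma L_element_eq:
  "L_element =
     dashed (abs_lgauss (one_arrow Pos x1 x2)) - dashed (abs_lgauss (one_arrow Neg x1 x2)) +
     (dashed (abs_lgauss (one_arrow Pos x2 x1)) - dashed (abs_lgauss (one_arrow Neg x2 x1)))"
  by (simp add: L_element_def)

lemma arrow_inner_L_element:
  assumes D: "locally_labeled D"
  shows "arrow_inner L_element (frag_of (abs_lgauss D)) = mixed_sign_sum D"
proof -
  have g: "gauss_diagram D" using D by (simp add: locally_labeled_def)
  define J where "J \<epsilon> a b i = (if asign D i = Some \<epsilon> \<and> joins D i a b then 1 else 0 :: int)"
    for \<epsilon> a b i
  have "arrow_inner L_element (frag_of (abs_lgauss D)) =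
      (\<Sum>i \<in> arrows D. J Pos x1 x2 i - J Neg x1 x2 i + (J Pos x2 x1 i - J Neg x2 x1 i))"
    by (simp add: L_element_eq arrow_inner_add_left arrow_inner_diff_left
        arrow_inner_one_arrow[OF D] J_def sum.distrib sum_subtractf)
  also have "\<dots> = (\<Sum>i \<in> arrows D.
      if \<exists>a b. a \<noteq> b \<and> joins D i a b then csign_val (the (asign D i)) else 0)"
  proof (rule sum.cong[OF refl])
    fix i assume "i \<in> arrows D"
    then obtain \<epsilon> where \<epsilon>: "asign D i = Some \<epsilon>" by (auto simp: arrows_def)
    \<comment> \<open>As \<open>X1\<close> has two elements, different labels mean one of two
      ordered pairs. The pairs exclude each other, so exactly one of the four indicators survives
      for a mixed arrow, weighted by its sign.\<close>
    have "\<not> (joins D i x1 x2 \<and> joins D i x2 x1)" using joins_unique[OF g] by blast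
    moreover have "(\<exists>a b. a \<noteq> b \<and> joins D i a b) \<longleftrightarrow> joins D i x1 x2 \<or> joins D i x2 x1"
      by (metis X1.distinct(1) X1.exhaust)
    ultimately show "J Pos x1 x2 i - J Neg x1 x2 i + (J Pos x2 x1 i - J Neg x2 x1 i) =
        (if \<exists>a b. a \<noteq> b \<and> joins D i a b then csign_val (the (asign D i)) else 0)"
      by (cases \<epsilon>) (auto simp: J_def \<epsilon>)
  qed
  also have "\<dots> = mixed_sign_sum D"
    unfolding mixed_sign_sum_def mixed_arrows_def
    using gauss_diagram_finite[OF g] by (simp add: sum.inter_filter)
  finally show ?thesis .
qed

text \<open>On a generator the pairing is a difference of two signed counts, which agree by
  invariance. The elements orthogonal to \<open>L_element\<close> form a subspace, so the whole span
  is covered.\<close>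

lemma L_element_in_polyak_algebra: "L_element \<in> polyak_algebra"
proof -
  interpret module "frag_cmul :: int \<Rightarrow> arrow_algebra \<Rightarrow> arrow_algebra"
    by (rule module_arrow_algebra)
  have gen: "arrow_inner L_element R = 0" if R: "R \<in> reidemeister_differences" for R
  proof -
    obtain D D' where R_eq: "R = frag_of (abs_lgauss D) - frag_of (abs_lgauss D')"
      and l: "locally_labeled D" "locally_labeled D'"
      and r: "reidemeister1 D D' \<or> reidemeister2 D D' \<or> reidemeister3 D D'"
      using R unfolding reidemeister_differences_def mem_Collect_eq by (elim exE conjE) rule
    have "gauss_diagram D" "gauss_diagram D'" using l by (simp_all add: locally_labeled_def)
    then have "mixed_sign_sum D = mixed_sign_sum D'"
      using r reidemeister1_mixed_sign_sum reidemeister2_mixed_sign_sum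
        reidemeister3_mixed_sign_sum by blast
    then show ?thesis by (simp add: R_eq arrow_inner_diff_right arrow_inner_L_element l)
  qed
  have "subspace {R. arrow_inner L_element R = 0}"
    by (rule subspaceI)
      (simp_all add: arrow_inner_zero_right arrow_inner_add_right arrow_inner_cmul_right)
  then have "span reidemeister_differences \<subseteq> {R. arrow_inner L_element R = 0}"
    by (rule span_minimal[rotated]) (use gen in blast)
  then show ?thesis unfolding polyak_algebra_def by blast
qed

text \<open>Truncation fixes every dashed diagram of degree one. The bound is written
  \<open>Suc 0\<close>, the simplifier's normal form of \<open>1\<close>.\<close>

lemma truncate_L_element: "truncate_algebra (Suc 0) L_element = L_element"
proof -
  have "degree (abs_lgauss (one_arrow \<epsilon> a b)) = 1" for \<epsilon> a b
    using locally_labeled_one_arrow[of \<epsilon> a b]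
    by (simp add: degree.abs_eq lgauss_rel_def diagram_iso_refl arrows_one_arrow)
  then show ?thesis
    by (simp add: truncate_algebra_def L_element_eq dashed_coords_add dashed_coords_diff
        frag_extend_add frag_extend_diff)
qed


section \<open>Labelings and the linking number\<close>

text \<open>\<open>restrict\<close> gives \<open>undefined\<close> off the semiarcs, matching the
  extensional functions in \<open>labelings\<close>.\<close>

definition component_labeling :: "'l diagram \<Rightarrow> X1 \<Rightarrow> X1 \<Rightarrow> bool \<times> nat \<Rightarrow> X1" where
  "component_labeling K a b = restrict (\<lambda>(c, j). if c then b else a) (semiarcs K)"

lemma component_labeling_apply:
  "j < length (circ K c) \<Longrightarrow> component_labeling K a b (c, j) = (if c then b else a)"
  by (simp add: component_labeling_def semiarcs_def)

lemma labeling_constant: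
  assumes "\<phi> \<in> labelings K" "j < max 1 (length (circ K c))"
  shows "\<phi> (c, j) = \<phi> (c, 0)"
  using assms(2)
proof (induction j)
  case (Suc j)
  \<comment> \<open>A positive index below \<open>max 1 (length (circ K c))\<close> forces the
    circle to have crossing points, so the labeling rule applies at \<open>j\<close>, without
    wrapping around.\<close>
  then have j: "Suc j < length (circ K c)" by simp
  have "\<forall>b j. j < length (circ K b) \<longrightarrow> \<phi> (b, Suc j mod length (circ K b)) = \<phi> (b, j)"
    using assms(1) by (simp add: labelings_def)
  then have "\<phi> (c, Suc j) = \<phi> (c, j)" using j by (metis Suc_lessD mod_less)
  then show ?case using Suc by simp
qed simp

text \<open>The rule propagates the label of semiarc \<open>0\<close> around its circle, so a
  labeling amounts to an independent choice of one label per circle.\<close>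

lemma labelings_eq: "labelings K = case_prod (component_labeling K) ` UNIV"
proof (intro equalityI subsetI)
  fix \<phi> assume \<phi>: "\<phi> \<in> labelings K"
  have "\<phi> = component_labeling K (\<phi> (False, 0)) (\<phi> (True, 0))"
  proof
    fix s :: "bool \<times> nat"
    obtain c j where s: "s = (c, j)" by (cases s)
    show "\<phi> s = component_labeling K (\<phi> (False, 0)) (\<phi> (True, 0)) s"
    proof (cases "s \<in> semiarcs K")
      case True
      then show ?thesis
        using labeling_constant[OF \<phi>, of j c]
        by (cases c) (auto simp: s component_labeling_def semiarcs_def)
    next
      case False
      have "\<phi> \<in> semiarcs K \<rightarrow>\<^sub>E UNIV" using \<phi> unfolding labelings_def by blast
      then have "\<phi> s = undefined" using False by (rule PiE_arb)
      then show ?thesis using False by (simp add: component_labeling_def)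
    qed
  qed
  then show "\<phi> \<in> case_prod (component_labeling K) ` UNIV" by (metis UNIV_I image_eqI prod.case)
next
  fix \<phi> assume "\<phi> \<in> case_prod (component_labeling K) ` UNIV"
  then obtain a b where \<phi>: "\<phi> = component_labeling K a b" by auto
  have "component_labeling K a b (c, Suc j mod length (circ K c)) = component_labeling K a b (c, j)"
    if "j < length (circ K c)" for c j
  proof -
    have "Suc j mod length (circ K c) < length (circ K c)"
      using that by (intro mod_less_divisor) linarith
    then show ?thesis using that by (simp add: component_labeling_apply)
  qed
  moreover have "component_labeling K a b \<in> semiarcs K \<rightarrow>\<^sub>E UNIV"
    by (simp add: component_labeling_def)
  ultimately show "\<phi> \<in> labelings K" by (simp add: \<phi> labelings_def)
qed

text \<open>Semiarc \<open>0\<close> exists even on a circle without crossing points, so both labels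
  can be read off. The four labelings are therefore distinct in the invariant's sum.\<close>

lemma inj_component_labeling: "inj (case_prod (component_labeling K))"
proof (rule injI, clarify)
  fix a b a' b' assume eq: "component_labeling K a b = component_labeling K a' b'"
  show "a = a' \<and> b = b'"
    using fun_cong[OF eq, of "(False, 0)"] fun_cong[OF eq, of "(True, 0)"]
    by (simp add: component_labeling_def semiarcs_def less_max_iff_disj)
qed

section \<open>The labeled diagrams of the four labelings\<close>

lemma circ_labeled_diagram:
  "circ (labeled_diagram K (component_labeling K a b)) c =
     map (\<lambda>(i, e, _). (i, e, if c then b else a, if c then b else a)) (circ K c)"
proof (rule nth_equalityI)
  show "length (circ (labeled_diagram K (component_labeling K a b)) c) =
      length (map (\<lambda>(i, e, _). (i, e, if c then b else a, if c then b else a)) (circ K c))"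
    by (simp add: labeled_diagram_def)
next
  fix j assume "j < length (circ (labeled_diagram K (component_labeling K a b)) c)"
  then have j: "j < length (circ K c)" by (simp add: labeled_diagram_def)
  then have "Suc j mod length (circ K c) < length (circ K c)"
    by (intro mod_less_divisor) linarith
  then show "circ (labeled_diagram K (component_labeling K a b)) c ! j =
      map (\<lambda>(i, e, _). (i, e, if c then b else a, if c then b else a)) (circ K c) ! j"
    using j by (simp add: labeled_diagram_def component_labeling_apply split: prod.splits)
qed

lemma asign_labeled_diagram: "asign (labeled_diagram K \<phi>) = asign K"
  by (simp add: labeled_diagram_def)

lemma endpoints_labeled_diagram:
  "endpoints (labeled_diagram K (component_labeling K a b)) c = endpoints K c"
  by (auto simp: endpoints_def circ_labeled_diagram endpoint_def)

lemma locally_labeled_labeled_diagram: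
  assumes "gauss_diagram K"
  shows "locally_labeled (labeled_diagram K (component_labeling K a b))"
  using assms unfolding locally_labeled_def gauss_diagram_def endpoints_labeled_diagram
  by (auto simp: circ_labeled_diagram arrows_def asign_labeled_diagram)

lemma mem_endpoints_iff: "(i, e) \<in> set (endpoints K c) \<longleftrightarrow> (\<exists>l. (i, e, l) \<in> set (circ K c))"
  by (force simp: endpoints_def endpoint_def)

text \<open>Each end carries the label of its circle, so the labels at the two ends differ exactly
  when the ends lie on different circles and these are labeled differently.\<close>

lemma joins_labeled_diagram:
  "(\<exists>a' b'. a' \<noteq> b' \<and> joins (labeled_diagram K (component_labeling K a b)) i a' b') \<longleftrightarrow>
     a \<noteq> b \<and> multicomponent K i"
proof -
  have mem: "(i, e, l, l) \<in> set (circ (labeled_diagram K (component_labeling K a b)) c) \<longleftrightarrow>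
      l = (if c then b else a) \<and> (i, e) \<in> set (endpoints K c)" for e l c
    by (force simp: circ_labeled_diagram mem_endpoints_iff)
  show ?thesis
  proof
    assume "\<exists>a' b'. a' \<noteq> b' \<and> joins (labeled_diagram K (component_labeling K a b)) i a' b'"
    then obtain c where "(if c then b else a) \<noteq> (if \<not> c then b else a)"
      and c: "(i, Tail) \<in> set (endpoints K c)" "(i, Head) \<in> set (endpoints K (\<not> c))"
      unfolding joins_def mem by blast
    then have "a \<noteq> b" by auto
    then show "a \<noteq> b \<and> multicomponent K i" using c by (auto simp: multicomponent_def)
  next
    assume *: "a \<noteq> b \<and> multicomponent K i"
    then obtain c where "(i, Tail) \<in> set (endpoints K c)" "(i, Head) \<in> set (endpoints K (\<not> c))"
      by (auto simp: multicomponent_def)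
    then have "joins (labeled_diagram K (component_labeling K a b)) i
        (if c then b else a) (if \<not> c then b else a)"
      unfolding joins_def mem by blast
    moreover have "(if c then b else a) \<noteq> (if \<not> c then b else a)" using * by auto
    ultimately
    show "\<exists>a' b'. a' \<noteq> b' \<and> joins (labeled_diagram K (component_labeling K a b)) i a' b'"
      by blast
  qed
qed

lemma mixed_sign_sum_labeled_diagram:
  "mixed_sign_sum (labeled_diagram K (component_labeling K a b)) =
     (if a \<noteq> b then \<Sum>i | i \<in> arrows K \<and> multicomponent K i. csign_val (the (asign K i)) else 0)"
  by (simp add: mixed_sign_sum_def mixed_arrows_def joins_labeled_diagram asign_labeled_diagram
      arrows_def)

lemma UNIV_X1: "UNIV = {x1, x2}"
  using X1.exhaust by blast

theorem theorem2:
  fixes K :: "unit diagram"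
  assumes "gauss_diagram K"
    and "even_crossing_points K"
  shows "L_element \<in> truncated_polyak_algebra 1 \<and>
    (\<exists>n. of_int n = 2 * lk K \<and> enhanced_invariant L_element K = 2 + 2 * u_pow n)"
proof
  show "L_element \<in> truncated_polyak_algebra 1"
    by (simp add: truncated_polyak_algebra_def L_element_in_polyak_algebra truncate_L_element)
  \<comment> \<open>The exponent has to be an integer, whereas \<open>lk\<close> is rational;
    \<open>n\<close> is the sum of signs before halving.\<close>
  define n where "n = (\<Sum>i | i \<in> arrows K \<and> multicomponent K i. csign_val (the (asign K i)))"
  have "of_int n = 2 * lk K" by (simp add: lk_def n_def)
  moreover have "enhanced_invariant L_element K = 2 + 2 * u_pow n"
  proof -
    have "enhanced_invariant L_element K =
        (\<Sum>(a, b) \<in> UNIV. u_pow (arrow_inner L_element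
           (frag_of (abs_lgauss (labeled_diagram K (component_labeling K a b))))))"
      unfolding enhanced_invariant_def labelings_eq
      by (subst sum.reindex[OF inj_component_labeling]) (simp add: case_prod_unfold)
    also have "\<dots> = (\<Sum>(a, b) \<in> {x1, x2} \<times> {x1, x2}. u_pow (if a \<noteq> b then n else 0))"
      by (simp add: arrow_inner_L_element locally_labeled_labeled_diagram[OF assms(1)]
          mixed_sign_sum_labeled_diagram flip: n_def UNIV_X1 cong: if_cong)
    \<comment> \<open>The two constant choices each give \<open>u_pow 0\<close>, the unit of the
      group ring, and the two others each give \<open>u_pow n\<close>.\<close>
    also have "\<dots> = 2 + 2 * u_pow n"
      by (simp add: u_pow_def single_one)
    finally show ?thesis .
  qed
  ultimately show "\<exists>n. of_int n = 2 * lk K \<and> enhanced_invariant L_element K = 2 + 2 * u_pow n"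
    by blast
qed

end
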